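(* Assume the Collatz conjecture. For every integer $n\ge 1$, the number of Collatz permutations of length $n$ is at least $F_n$ and at most $2F_n$.
   Context: $F_n$ denotes the $n$-th Fibonacci number, with $F_1=F_2=1$ and $F_n=F_{n-1}+F_{n-2}$ for $n>2$. The Collatz map on positive integers is $f(x)=x/2$ if $x$ is even and $f(x)=3x+1$ if $x$ is odd. The Collatz conjecture (a standing assumption of the paper) states that for every positive integer $x$ some iterate $f^{m}(x)$ equals $1$. Let $x$ be a positive integer that is not a power of two (here $1=2^0$ counts as a power of two). The trace of $x$ is the finite sequence $x, f(x), f^2(x),\dots,f^{n-1}(x)$ of iterates strictly before the first power of two in the orbit; that is, $n\ge 1$ is the least integer such that $f^{n}(x)$ is a power of two. The elements of a trace are distinct. The Collatz permutation $C(x)$ is the permutation of $\{1,\dots,n\}$, in one-line notation, obtained from the trace of $x$ by replacing each element by its rank (the $i$-th smallest element is replaced by $i$). A Collatz permutation of length $n$ is a permutation of $\{1,\dots,n\}$ equal to $C(x)$ for some such $x$. *)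

theory Defs
  imports
    "HOL-Number_Theory.Fib"
    "HOL-Combinatorics.Multiset_Permutations"
begin

(* The value at 0 is irrelevant: only positive starting points are ever considered. *)
definition collatz :: "nat \<Rightarrow> nat" where
  "collatz x = (if even x then x div 2 else 3 * x + 1)"

definition collatz_conjecture :: bool where
  "collatz_conjecture \<longleftrightarrow> (\<forall>x>0. \<exists>m. (collatz ^^ m) x = 1)"

definition power_of_two :: "nat \<Rightarrow> bool" where
  "power_of_two x \<longleftrightarrow> (\<exists>k. x = 2 ^ k)"

(* Meaningful only if the orbit of x reaches a power of two, which the Collatz conjecture
   guarantees for positive x. *)
definition trace_length :: "nat \<Rightarrow> nat" where
  "trace_length x = (LEAST n. n \<ge> 1 \<and> power_of_two ((collatz ^^ n) x))"

definition collatz_trace :: "nat \<Rightarrow> nat list" where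
  "collatz_trace x = map (\<lambda>i. (collatz ^^ i) x) [0..<trace_length x]"

(* The i-th smallest entry is replaced by i, with ranks starting at 1. *)
definition standardize :: "nat list \<Rightarrow> nat list" where
  "standardize xs = map (\<lambda>a. card {b \<in> set xs. b \<le> a}) xs"

definition collatz_perm :: "nat \<Rightarrow> nat list" where
  "collatz_perm x = standardize (collatz_trace x)"

(* Permutations of {1..n} in one-line notation are the duplicate-free lists with entry set {1..n}. *)
definition collatz_permutations :: "nat \<Rightarrow> nat list set" where
  "collatz_permutations n =
     {p \<in> permutations_of_set {1..n}. \<exists>x>0. \<not> power_of_two x \<and> p = collatz_perm x}"

end

theory Submission
  imports Defs "HOL-Number_Theory.Residue_Primitive_Roots"
begin

text \<open>
  Record a trace of length \<open>n\<close> by its parity word, which says for each entry whether it is odd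
  (an up-step \<open>x \<mapsto> 3 x + 1\<close> follows) or even (a down-step follows).  An up-step produces an even
  number, so no two up-steps are adjacent; and a power of two is first reached by an up-step, since
  halving a number that is not a power of two does not give one.  The words of length \<open>n\<close> with
  these two properties are counted by \<open>fib n\<close>.  The Collatz permutation determines the parity word,
  because an entry is smaller than its successor exactly when it is odd.  So it suffices to show
  that every such word belongs to at least one and at most two Collatz permutations.

  At least one (\<open>parity_word_has_trace\<close>): run the word backwards from a power \<open>2 ^ k\<close>.  Undoing
  an up-step requires the current number to be congruent to 1 modulo 3, so the whole word
  constrains \<open>2 ^ k\<close> modulo a power of 3.  As 2 is a primitive root modulo every power of 3, a
  suitable, arbitrarily large \<open>k\<close> exists.

  At most two (\<open>card_collatz_perm_parities\<close>): a segment of a trace with \<open>a\<close> up-steps and \<open>b\<close>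
  down-steps maps \<open>y\<close> to \<open>(3 ^ a * y + c) / 2 ^ b\<close>, where \<open>c\<close> depends only on the parities.
  For large \<open>y\<close> this exceeds \<open>y\<close> if and only if \<open>2 ^ b < 3 ^ a\<close>, so the word alone dictates
  an order of the entries.  A pair of entries violating this asymptotic order must have its first
  entry below \<open>9 ^ a\<close>, and then the final power \<open>2 ^ k\<close> is small: with \<open>A\<close> up-steps in the whole
  trace, \<open>k < 6 * A - 4\<close> (\<open>exceptional_trace_end\<close>).  On the other hand, if two distinct starting
  points have the same parity word, then their final exponents differ by a positive multiple of the order
  \<open>2 * 3 ^ (A - 1)\<close> of 2 modulo \<open>3 ^ A\<close> (\<open>end_exponent_gap\<close>).  Hence every starting point with
  the given word, except possibly the least one, has too large a final exponent to violate the
  asymptotic order, and all of these share one permutation.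
\<close>

section \<open>Parity words and Fibonacci numbers\<close>

text \<open>
  The recursion is by the first letter, where \<open>True\<close> stands for an odd entry.  An odd entry that is
  not the last one is followed by an even one, so the two letters are split off together.
\<close>

fun parity_words :: "nat \<Rightarrow> bool list set" where
  "parity_words 0 = {}"
| "parity_words (Suc 0) = {[True]}"
| "parity_words (Suc (Suc n)) =
     (#) False ` parity_words (Suc n) \<union> (\<lambda>w. True # False # w) ` parity_words n"

lemma finite_parity_words [simp]: "finite (parity_words n)"
  by (induction n rule: parity_words.induct) auto

lemma card_parity_words: "card (parity_words n) = fib n"
proof (induction n rule: parity_words.induct)
  case (3 n)
  have "card (parity_words (Suc (Suc n))) =
      card ((#) False ` parity_words (Suc n)) + card ((\<lambda>w. True # False # w) ` parity_words n)"
    unfolding parity_words.simps by (intro card_Un_disjoint) auto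
  also have "\<dots> = fib (Suc n) + fib n"
    using 3 by (simp add: card_image inj_on_def)
  finally show ?case by simp
qed auto

lemma last_parity_words: "w \<in> parity_words n \<Longrightarrow> w \<noteq> [] \<and> last w"
  by (induction n arbitrary: w rule: parity_words.induct) auto

definition parities :: "nat \<Rightarrow> nat \<Rightarrow> bool list" where
  "parities n x = map (\<lambda>i. odd ((collatz ^^ i) x)) [0..<n]"

lemma length_parities [simp]: "length (parities n x) = n"
  by (simp add: parities_def)

lemma parities_0 [simp]: "parities 0 x = []"
  by (simp add: parities_def)

lemma parities_Suc: "parities (Suc n) x = odd x # parities n (collatz x)"
  by (simp add: parities_def map_upt_Suc funpow_swap1 del: upt_Suc)

lemma parities_add: "parities (m + n) x = parities m x @ parities n ((collatz ^^ m) x)"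
  by (induction m arbitrary: x) (simp_all add: parities_Suc funpow_swap1)

lemma funpow_collatz_add: "(collatz ^^ (m + n)) x = (collatz ^^ n) ((collatz ^^ m) x)"
  by (simp add: add.commute[of m] funpow_add)

lemma collatz_pos: "x > 0 \<Longrightarrow> collatz x > 0"
  by (auto simp: collatz_def elim: evenE)

lemma funpow_collatz_pos: "x > 0 \<Longrightarrow> (collatz ^^ n) x > 0"
  by (induction n) (auto simp: collatz_pos)

section \<open>Traces\<close>

lemma power_of_two_double: "even x \<Longrightarrow> power_of_two (x div 2) \<Longrightarrow> power_of_two x"
  unfolding power_of_two_def by (metis dvd_mult_div_cancel power_Suc)

lemma power_of_two_half: "x \<noteq> 1 \<Longrightarrow> power_of_two x \<Longrightarrow> even x \<and> power_of_two (x div 2)"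
  unfolding power_of_two_def
proof (elim exE)
  fix k assume "x \<noteq> 1" "x = 2 ^ k"
  then show "even x \<and> (\<exists>j. x div 2 = 2 ^ j)" by (cases k) auto
qed

lemma power_of_two_1: "power_of_two 1"
  unfolding power_of_two_def by (rule exI[of _ 0]) simp

lemma power_of_two_4: "power_of_two 4"
  unfolding power_of_two_def by (rule exI[of _ 2]) simp

lemma power_of_two_collatz:
  assumes "power_of_two x"
  shows "power_of_two (collatz x)"
proof (cases "x = 1")
  case True
  then show ?thesis using power_of_two_4 by (simp add: collatz_def)
next
  case False
  then show ?thesis using power_of_two_half[of x] assms by (simp add: collatz_def)
qed

lemma power_of_two_funpow_collatz: "power_of_two x \<Longrightarrow> power_of_two ((collatz ^^ n) x)"
  by (induction n) (auto simp: power_of_two_collatz)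

definition has_trace :: "nat \<Rightarrow> nat \<Rightarrow> bool" where
  "has_trace n x \<longleftrightarrow>
     x > 0 \<and> n \<ge> 1 \<and> power_of_two ((collatz ^^ n) x) \<and> (\<forall>i<n. \<not> power_of_two ((collatz ^^ i) x))"

lemma has_traceD:
  assumes "has_trace n x"
  shows "x > 0" "\<not> power_of_two x" "trace_length x = n"
proof -
  show "x > 0" using assms by (simp add: has_trace_def)
  show "\<not> power_of_two x"
    using assms unfolding has_trace_def by (metis funpow_0 less_eq_Suc_le One_nat_def)
  show "trace_length x = n"
    unfolding trace_length_def using assms
    by (intro Least_equality) (auto simp: has_trace_def not_less[symmetric])
qed

lemma has_trace_trace_length:
  assumes "collatz_conjecture" "x > 0" "\<not> power_of_two x"
  shows "has_trace (trace_length x) x"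
proof -
  obtain m where m: "(collatz ^^ m) x = 1"
    using assms(1,2) by (auto simp: collatz_conjecture_def)
  have "m \<noteq> 0"
    using m assms(3) power_of_two_1 by (intro notI) simp
  then have ex: "m \<ge> 1 \<and> power_of_two ((collatz ^^ m) x)"
    using m power_of_two_1 by simp
  let ?P = "\<lambda>n. n \<ge> 1 \<and> power_of_two ((collatz ^^ n) x)"
  have P: "?P (trace_length x)"
    unfolding trace_length_def using ex by (rule LeastI)
  have "\<not> power_of_two ((collatz ^^ i) x)" if "i < trace_length x" for i
  proof (cases "i = 0")
    case True
    then show ?thesis using assms(3) by simp
  next
    case False
    then show ?thesis
      using not_less_Least[of i ?P] that unfolding trace_length_def by simp
  qed
  then show ?thesis using P assms(2) by (simp add: has_trace_def)
qed

text \<open>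
  Powers of two are closed under the Collatz map, so inspecting the entry just before the end is
  enough to exclude an earlier power of two.
\<close>

lemma has_traceI:
  assumes "n \<ge> 1" "power_of_two ((collatz ^^ n) x)" "\<not> power_of_two ((collatz ^^ (n - 1)) x)" "x > 0"
  shows "has_trace n x"
proof -
  have "\<not> power_of_two ((collatz ^^ i) x)" if "i < n" for i
    using power_of_two_funpow_collatz[of "(collatz ^^ i) x" "n - 1 - i"] assms that
    by (auto simp: funpow_collatz_add[symmetric])
  then show ?thesis using assms by (simp add: has_trace_def)
qed

text \<open>
  If two entries agreed, cutting out the cycle between them would reach the power of two earlier.
\<close>

lemma has_trace_inj:
  assumes "has_trace n x"
  shows "inj_on (\<lambda>i. (collatz ^^ i) x) {..<n}"
proof (rule linorder_inj_onI')
  fix i j assume ij: "i \<in> {..<n}" "j \<in> {..<n}" "i < j"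
  show "(collatz ^^ i) x \<noteq> (collatz ^^ j) x"
  proof
    assume eq: "(collatz ^^ i) x = (collatz ^^ j) x"
    have "(collatz ^^ (i + (n - j))) x = (collatz ^^ (j + (n - j))) x"
      unfolding funpow_collatz_add eq ..
    then have "power_of_two ((collatz ^^ (i + (n - j))) x)"
      using assms ij by (simp add: has_trace_def)
    moreover have "i + (n - j) < n" using ij by auto
    ultimately show False using assms by (simp add: has_trace_def)
  qed
qed

lemma collatz_odd_even: "odd x \<Longrightarrow> even (collatz x)"
  by (simp add: collatz_def)

lemma parities_in_parity_words:
  assumes "has_trace n x"
  shows "parities n x \<in> parity_words n"
proof -
  have "power_of_two ((collatz ^^ n) x) \<Longrightarrow> \<forall>i<n. \<not> power_of_two ((collatz ^^ i) x) \<Longrightarrow> n \<ge> 1 \<Longrightarrow>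
      parities n x \<in> parity_words n" for n x
  proof (induction n arbitrary: x rule: parity_words.induct)
    case 2
    then have "odd x"
      using power_of_two_double[of x] by (auto simp: collatz_def split: if_splits)
    then show ?case by (simp add: parities_Suc)
  next
    case (3 n)
    have later: "\<not> power_of_two ((collatz ^^ i) (collatz x))" if "i < Suc n" for i
      using 3(4)[rule_format, of "Suc i"] that by (simp add: funpow_swap1)
    show ?case
    proof (cases "even x")
      case True
      have "parities (Suc n) (collatz x) \<in> parity_words (Suc n)"
        using 3(1)[of "collatz x"] 3(3) later by (simp add: funpow_swap1)
      then show ?thesis using True by (simp add: parities_Suc)
    next
      case False
      let ?y = "collatz (collatz x)"
      have ev: "even (collatz x)" using False by (rule collatz_odd_even)
      then have "?y = collatz x div 2" by (simp add: collatz_def[of "collatz x"])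
      with ev later[of 0] have "\<not> power_of_two ?y"
        using power_of_two_double by auto
      with 3(3) have "n \<noteq> 0" by (intro notI) simp
      have "parities n ?y \<in> parity_words n"
        using 3(2)[of ?y] 3(3) later[of "Suc _"] \<open>n \<noteq> 0\<close> by (simp add: funpow_swap1)
      then show ?thesis using False ev by (simp add: parities_Suc)
    qed
  qed simp
  then show ?thesis using assms by (simp add: has_trace_def)
qed

text \<open>
  The last entry \<open>y\<close> is odd and different from 1, so the power of two \<open>3 * y + 1\<close> exceeds 4.
\<close>

lemma trace_end:
  assumes "has_trace n x" "(collatz ^^ n) x = 2 ^ k"
  shows "k \<ge> 3"
proof -
  let ?y = "(collatz ^^ (n - 1)) x"
  have n: "n \<ge> 1" using assms(1) by (simp add: has_trace_def)
  have "collatz ?y = 2 ^ k"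
    using assms(2) n funpow_collatz_add[of "n - 1" 1 x] by simp
  moreover have np: "\<not> power_of_two ?y" using assms(1) n by (simp add: has_trace_def)
  moreover have "odd ?y"
    using np power_of_two_double[of ?y] calculation(1)
    by (auto simp: collatz_def power_of_two_def split: if_splits)
  moreover have "?y \<noteq> 1" using np power_of_two_1 by auto
  ultimately have "(2::nat) ^ k > 2 ^ 2"
    using odd_pos[of ?y] by (auto simp: collatz_def)
  then show ?thesis using power_less_imp_less_exp[of "2::nat" 2 k] by simp
qed

section \<open>Every parity word is realised\<close>

text \<open>
  2 is a primitive root modulo 3, and it lifts to all powers of 3 because \<open>2 ^ 2\<close> is not congruent
  to 1 modulo 9.
\<close>

lemma two_primroot_power_three:
  assumes "m > 0"
  shows "residue_primroot (3 ^ m) (2::nat)"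
proof -
  have "ord 3 (2::nat) dvd 2"
    by (subst ord_divides[symmetric]) (simp add: cong_def)
  then have "ord 3 (2::nat) \<le> 2" by (rule dvd_imp_le) simp
  moreover have "ord 3 (2::nat) \<noteq> 1"
    using ord_divides[of "2::nat" 1 3] by (auto simp: cong_def)
  moreover have cop: "coprime 3 (2::nat)" by (simp add: coprime_iff_gcd_eq_1 gcd_red_nat[of 3 2])
  moreover have "ord 3 (2::nat) \<noteq> 0" using cop by (simp add: ord_eq_0)
  ultimately have "ord 3 (2::nat) = 2" by linarith
  with cop have "residue_primroot 3 (2::nat)"
    by (simp add: residue_primroot_def totient_prime)
  moreover have "[2 ^ (3 - 1) \<noteq> (1::nat)] (mod 3\<^sup>2)" by (simp add: cong_def)
  ultimately show ?thesis
    using residue_primroot_prime_lift_iff[of 3 2] assms by simp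
qed

lemma power_two_surj_mod_power_three:
  fixes r N m :: nat
  assumes "\<not> 3 dvd r" "m > 0"
  shows "\<exists>k\<ge>N. [2 ^ k = r] (mod 3 ^ m)"
proof -
  let ?q = "(3::nat) ^ m"
  have q: "?q > 1" using assms(2) by (intro one_less_power) auto
  have pr: "residue_primroot ?q 2" using assms(2) by (rule two_primroot_power_three)
  have cop: "coprime ?q r"
    using assms(1) by (simp add: prime_imp_coprime)
  have "r mod ?q \<in> totatives ?q"
  proof -
    have c: "coprime (r mod ?q) ?q"
      using coprime_mod_left_iff[of ?q r] cop q by (simp only: coprime_commute[of r ?q])
    then have "r mod ?q \<noteq> 0" using q by (intro notI) simp
    moreover have "r mod ?q \<le> ?q" using q by (simp add: less_imp_le)
    ultimately show ?thesis using c by (simp add: totatives_def)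
  qed
  also have "\<dots> = (\<lambda>i. 2 ^ i mod ?q) ` {..<totient ?q}"
    using residue_primroot_is_generator[OF q pr] by (simp add: bij_betw_def)
  finally obtain i where i: "[2 ^ i = r] (mod ?q)" by (auto simp: cong_def)
  have tot: "totient ?q > 0" using q by simp
  have "[2 ^ (totient ?q * N) = (1::nat)] (mod ?q)"
    using pr by (subst ord_divides) (simp add: residue_primroot_def)
  with i have "[2 ^ (i + totient ?q * N) = r * 1] (mod ?q)"
    unfolding power_add by (rule cong_mult)
  moreover have "i + totient ?q * N \<ge> N" using tot by (cases "totient ?q") auto
  ultimately show ?thesis by auto
qed

text \<open>
  Prescribing the residue of the starting point modulo an arbitrary power of 3 is what makes the
  induction work: undoing a down-step divides the required residue by 2, and undoing an up-step turns
  \<open>x \<equiv> t\<close> modulo \<open>3 ^ m\<close> into \<open>3 * x + 1 \<equiv> 3 * t + 1\<close> modulo \<open>3 ^ (m + 1)\<close>, which also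
  ensures that the division by 3 is exact.  After the last letter, the requirement concerns the power
  of two itself.
\<close>

lemma parity_word_realised:
  assumes "w \<in> parity_words n"
  shows "\<exists>x k. x > 0 \<and> k \<ge> N \<and> parities n x = w \<and> (collatz ^^ n) x = 2 ^ k \<and> [x = t] (mod 3 ^ m)"
  using assms
proof (induction n arbitrary: w t m rule: parity_words.induct)
  case 2
  have "\<not> 3 dvd 1 + 3 * t" by presburger
  then obtain k where k: "k \<ge> Suc N" "[2 ^ k = 1 + 3 * t] (mod 3 ^ Suc m)"
    using power_two_surj_mod_power_three[of "1 + 3 * t" "Suc m" "Suc N"] by auto
  have ev: "even ((2::nat) ^ k)" using k(1) by (cases k) auto
  have "[2 ^ k = 1 + 3 * t] (mod 3)"
    using k(2) cong_modulus_mult_nat[of _ _ 3 "3 ^ m"] by simp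
  then have "(2::nat) ^ k mod 3 = 1" by (simp add: cong_def)
  then obtain x where x: "2 ^ k = 3 * x + (1::nat)"
    by (metis mult_div_mod_eq)
  have "odd x" using ev unfolding x by simp
  have "[3 * x = 3 * t] (mod 3 * 3 ^ m)"
    using k(2) unfolding x add.commute[of 1] by (simp only: cong_add_rcancel_nat power_Suc)
  then have "[x = t] (mod 3 ^ m)" by (simp add: cong_def mult_mod_right[symmetric])
  then show ?case using 2 \<open>odd x\<close> x k(1)
    by (intro exI[of _ x] exI[of _ k]) (auto simp: parities_Suc collatz_def odd_pos)
next
  case (3 n)
  have half: "\<exists>t'. [2 * t' = s] (mod 3 ^ j)" for s j :: nat
  proof -
    have "coprime (2::nat) (3 ^ j)" by simp
    then obtain h where "[2 * h = (1::nat)] (mod 3 ^ j)" using cong_solve_coprime_nat[of 2 "3 ^ j"] by auto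
    then have "[2 * h * s = 1 * s] (mod 3 ^ j)" by (rule cong_scalar_right)
    then show ?thesis by (auto simp: mult.assoc)
  qed
  from 3(3) consider v where "w = False # v" "v \<in> parity_words (Suc n)"
    | v where "w = True # False # v" "v \<in> parity_words n" by auto
  then show ?case
  proof cases
    case 1
    obtain t' where t': "[2 * t' = t] (mod 3 ^ m)" using half by blast
    obtain x k where x: "x > 0" "k \<ge> N" "parities (Suc n) x = v" "(collatz ^^ Suc n) x = 2 ^ k"
      "[x = t'] (mod 3 ^ m)" using 3(1)[OF 1(2)] by blast
    have "[2 * x = t] (mod 3 ^ m)" using cong_scalar_left[OF x(5), of 2] t' by (rule cong_trans)
    moreover have "collatz (2 * x) = x" by (simp add: collatz_def)
    ultimately show ?thesis using 1 x
      by (intro exI[of _ "2 * x"] exI[of _ k]) (simp add: parities_Suc funpow_swap1)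
  next
    case 2
    obtain t' where t': "[2 * t' = 1 + 3 * t] (mod 3 ^ Suc m)" using half by blast
    obtain x k where x: "x > 0" "k \<ge> N" "parities n x = v" "(collatz ^^ n) x = 2 ^ k"
      "[x = t'] (mod 3 ^ Suc m)" using 3(2)[OF 2(2)] by blast
    have c: "[2 * x = 1 + 3 * t] (mod 3 ^ Suc m)"
      using cong_scalar_left[OF x(5), of 2] t' by (rule cong_trans)
    then have "[2 * x = 1 + 3 * t] (mod 3)"
      using cong_modulus_mult_nat[of _ _ 3 "3 ^ m"] by simp
    then have "(2 * x) mod 3 = 1" by (simp add: cong_def)
    then obtain y where y: "2 * x = 3 * y + 1"
      by (metis mult_div_mod_eq)
    have "odd y" using y by presburger
    have "[3 * y = 3 * t] (mod 3 * 3 ^ m)"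
      using c unfolding y add.commute[of 1] by (simp only: cong_add_rcancel_nat power_Suc)
    then have "[y = t] (mod 3 ^ m)" by (simp add: cong_def mult_mod_right[symmetric])
    moreover have "collatz y = 2 * x" "collatz (2 * x) = x"
      using y \<open>odd y\<close> by (auto simp: collatz_def)
    ultimately show ?thesis using 2 x \<open>odd y\<close>
      by (intro exI[of _ y] exI[of _ k]) (simp add: parities_Suc funpow_swap1 odd_pos)
  qed
qed simp

text \<open>
  A realisation ending in a power of two could meet a power of two too early only if its last entry,
  being odd, were 1.  Demanding an exponent of at least 3 rules this out.
\<close>

lemma parity_word_has_trace:
  assumes "w \<in> parity_words n"
  shows "\<exists>x. has_trace n x \<and> parities n x = w"
proof -
  obtain x k where x: "x > 0" "k \<ge> 3" "parities n x = w" "(collatz ^^ n) x = 2 ^ k"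
    using parity_word_realised[OF assms, of 3 0 0] by blast
  have n: "n \<ge> 1" using assms by (cases n) auto
  let ?y = "(collatz ^^ (n - 1)) x"
  have "last (parities n x) = odd ?y"
    using n by (simp add: parities_def last_map)
  then have odd: "odd ?y" using last_parity_words[OF assms] x(3) by simp
  have "collatz ?y = 2 ^ k"
    using n x(4) funpow_collatz_add[of "n - 1" 1 x] by simp
  then have "3 * ?y + 1 = 2 ^ k" using odd by (simp add: collatz_def)
  moreover have "(2::nat) ^ 3 \<le> 2 ^ k" using x(2) by (intro power_increasing) auto
  ultimately have "?y \<noteq> 1" by auto
  then have "\<not> power_of_two ?y" using power_of_two_half odd by blast
  then show ?thesis
    using has_traceI[of n x] n x by (auto simp: power_of_two_def)
qed

section \<open>Collatz permutations\<close>

lemma standardize_less_iff: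
  assumes "i < length xs" "j < length xs"
  shows "standardize xs ! i < standardize xs ! j \<longleftrightarrow> xs ! i < xs ! j"
proof -
  let ?r = "\<lambda>a. card {b \<in> set xs. b \<le> a}"
  have mono: "?r a \<le> ?r b" if "a \<le> b" for a b
    using that by (intro card_mono) auto
  have strict: "?r a < ?r b" if "a < b" "b \<in> set xs" for a b
  proof (intro psubset_card_mono psubsetI)
    have "b \<in> {c \<in> set xs. c \<le> b}" "b \<notin> {c \<in> set xs. c \<le> a}" using that by auto
    then show "{c \<in> set xs. c \<le> a} \<noteq> {c \<in> set xs. c \<le> b}" by blast
  qed (use that in auto)
  have "?r (xs ! i) < ?r (xs ! j) \<longleftrightarrow> xs ! i < xs ! j"
    using mono[of "xs ! j" "xs ! i"] strict[of "xs ! i" "xs ! j"] assms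
    by (meson not_less nth_mem)
  then show ?thesis using assms by (simp add: standardize_def)
qed

lemma standardize_permutation:
  assumes "distinct xs"
  shows "standardize xs \<in> permutations_of_set {1..length xs}"
proof
  have inj: "inj_on (\<lambda>i. standardize xs ! i) {..<length xs}"
  proof (rule inj_onI)
    fix i j assume ij: "i \<in> {..<length xs}" "j \<in> {..<length xs}"
      "standardize xs ! i = standardize xs ! j"
    then have "xs ! i = xs ! j"
      using standardize_less_iff[of i xs j] standardize_less_iff[of j xs i] by auto
    then show "i = j" using assms ij by (simp add: nth_eq_iff_index_eq)
  qed
  then show dist: "distinct (standardize xs)"
    by (simp add: distinct_conv_nth inj_on_def standardize_def) blast
  have "1 \<le> card {b \<in> set xs. b \<le> a} \<and> card {b \<in> set xs. b \<le> a} \<le> length xs" if "a \<in> set xs" for a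
  proof
    have "{b \<in> set xs. b \<le> a} \<noteq> {}" using that by auto
    then show "1 \<le> card {b \<in> set xs. b \<le> a}" by (simp add: Suc_le_eq card_gt_0_iff)
    have "card {b \<in> set xs. b \<le> a} \<le> card (set xs)" by (intro card_mono) auto
    then show "card {b \<in> set xs. b \<le> a} \<le> length xs" using card_length[of xs] by linarith
  qed
  then have "set (standardize xs) \<subseteq> {1..length xs}"
    by (auto simp: standardize_def)
  then show "set (standardize xs) = {1..length xs}"
    by (rule card_subset_eq[rotated]) (simp_all add: distinct_card[OF dist], simp add: standardize_def)
qed

lemma standardize_eqI:
  assumes "distinct xs" "distinct ys" "length xs = length ys"
    and "\<And>i j. i < length xs \<Longrightarrow> j < length xs \<Longrightarrow> xs ! i < xs ! j \<longleftrightarrow> ys ! i < ys ! j"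
  shows "standardize xs = standardize ys"
proof (rule nth_equalityI)
  show "length (standardize xs) = length (standardize ys)"
    using assms(3) by (simp add: standardize_def)
  fix i assume "i < length (standardize xs)"
  then have i: "i < length xs" by (simp add: standardize_def)
  have rank: "standardize zs ! i = card {j. j < length zs \<and> \<not> zs ! i < zs ! j}"
    if "distinct zs" "i < length zs" for zs :: "nat list"
  proof -
    have "{b \<in> set zs. b \<le> zs ! i} = (!) zs ` {j. j < length zs \<and> \<not> zs ! i < zs ! j}"
      by (auto simp: in_set_conv_nth)
    moreover have "inj_on ((!) zs) {j. j < length zs \<and> \<not> zs ! i < zs ! j}"
      using that(1) by (auto simp: inj_on_def nth_eq_iff_index_eq)
    ultimately show ?thesis using that(2) by (simp add: standardize_def card_image)
  qed
  have "{j. j < length xs \<and> \<not> xs ! i < xs ! j} = {j. j < length ys \<and> \<not> ys ! i < ys ! j}"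
    using assms(3,4) i by auto
  then show "standardize xs ! i = standardize ys ! i"
    using rank[OF assms(1)] rank[OF assms(2)] i assms(3) by simp
qed

lemma has_trace_collatz_trace:
  assumes "has_trace n x"
  shows "length (collatz_trace x) = n" "distinct (collatz_trace x)"
    "\<And>i. i < n \<Longrightarrow> collatz_trace x ! i = (collatz ^^ i) x"
  using has_trace_inj[OF assms] has_traceD(3)[OF assms]
  by (simp_all add: collatz_trace_def distinct_map atLeast0LessThan)

lemma collatz_permutations_eq:
  assumes "collatz_conjecture"
  shows "collatz_permutations n = collatz_perm ` {x. has_trace n x}"
proof (intro equalityI subsetI)
  fix p assume "p \<in> collatz_permutations n"
  then obtain x where x: "p \<in> permutations_of_set {1..n}" "x > 0" "\<not> power_of_two x"
    "p = collatz_perm x" by (auto simp: collatz_permutations_def)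
  have "length p = n" using length_finite_permutations_of_set[OF x(1)] by simp
  then have "trace_length x = n"
    using x(4) by (simp add: collatz_perm_def standardize_def collatz_trace_def)
  then show "p \<in> collatz_perm ` {x. has_trace n x}"
    using has_trace_trace_length[OF assms x(2,3)] x(4) by auto
next
  fix p assume "p \<in> collatz_perm ` {x. has_trace n x}"
  then obtain x where x: "has_trace n x" "p = collatz_perm x" by auto
  have "p \<in> permutations_of_set {1..n}"
    using standardize_permutation[OF has_trace_collatz_trace(2)[OF x(1)]]
      has_trace_collatz_trace(1)[OF x(1)] x(2) by (simp add: collatz_perm_def)
  then show "p \<in> collatz_permutations n"
    using x has_traceD[OF x(1)] by (auto simp: collatz_permutations_def)
qed

lemma collatz_perm_less_iff:
  assumes "has_trace n x" "i < n" "j < n"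
  shows "collatz_perm x ! i < collatz_perm x ! j \<longleftrightarrow> (collatz ^^ i) x < (collatz ^^ j) x"
  using standardize_less_iff[of i "collatz_trace x" j] has_trace_collatz_trace[OF assms(1)] assms(2,3)
  by (simp add: collatz_perm_def)

lemma collatz_greater_iff:
  assumes "x > 0"
  shows "x < collatz x \<longleftrightarrow> odd x"
  using assms by (auto simp: collatz_def)

text \<open>
  Reads the parity word off a Collatz permutation: odd entries are the ascents, together with the
  last position.
\<close>

definition perm_word :: "nat list \<Rightarrow> bool list" where
  "perm_word p = map (\<lambda>i. Suc i = length p \<or> p ! i < p ! Suc i) [0..<length p]"

lemma perm_word_collatz_perm:
  assumes "has_trace n x"
  shows "perm_word (collatz_perm x) = parities n x"
proof -
  have len: "length (collatz_perm x) = n"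
    using has_trace_collatz_trace(1)[OF assms] by (simp add: collatz_perm_def standardize_def)
  have "(Suc i = n \<or> collatz_perm x ! i < collatz_perm x ! Suc i) = odd ((collatz ^^ i) x)"
    if i: "i < n" for i
  proof (cases "Suc i = n")
    case True
    have "odd (last (map ((\<lambda>i. (collatz ^^ i) x)) [0..<n]))"
      using last_parity_words[OF parities_in_parity_words[OF assms]] True i
      by (auto simp: parities_def last_map)
    then show ?thesis using True by (auto simp: last_map)
  next
    case False
    then show ?thesis
      using i collatz_perm_less_iff[OF assms, of i "Suc i"]
        collatz_greater_iff[of "(collatz ^^ i) x"] has_traceD(1)[OF assms] funpow_collatz_pos
      by simp
  qed
  then show ?thesis unfolding perm_word_def parities_def len by simp
qed

section \<open>The order of a trace\<close>

abbreviation ups :: "bool list \<Rightarrow> nat" where "ups w \<equiv> count_list w True"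
abbreviation downs :: "bool list \<Rightarrow> nat" where "downs w \<equiv> count_list w False"

lemma ups_downs: "ups w + downs w = length w"
  by (induction w) auto

text \<open>
  The constant \<open>c\<close> in \<open>2 ^ b * y = 3 ^ a * x + c\<close>, where the word with \<open>a\<close> up-steps and \<open>b\<close>
  down-steps leads from \<open>x\<close> to \<open>y\<close>.
\<close>

fun offset :: "bool list \<Rightarrow> nat" where
  "offset [] = 0"
| "offset (True # w) = 3 ^ ups w + offset w"
| "offset (False # w) = 2 * offset w"

lemma funpow_collatz_affine:
  "2 ^ downs (parities n x) * (collatz ^^ n) x =
     3 ^ ups (parities n x) * x + offset (parities n x)"
proof (induction n arbitrary: x)
  case (Suc n)
  show ?case
  proof (cases "odd x")
    case True
    then show ?thesis using Suc.IH[of "collatz x"]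
      by (simp add: parities_Suc funpow_swap1) (simp add: collatz_def algebra_simps)
  next
    case False
    then have x: "x = 2 * collatz x" by (simp add: collatz_def)
    have "2 ^ downs (parities (Suc n) x) * (collatz ^^ Suc n) x =
        2 * (2 ^ downs (parities n (collatz x)) * (collatz ^^ n) (collatz x))"
      using False by (simp add: parities_Suc funpow_swap1)
    also have "\<dots> = 3 ^ ups (parities n (collatz x)) * (2 * collatz x)
        + 2 * offset (parities n (collatz x))"
      unfolding Suc.IH by simp
    also have "\<dots> = 3 ^ ups (parities (Suc n) x) * x + offset (parities (Suc n) x)"
      using False x[symmetric] by (simp add: parities_Suc)
    finally show ?thesis .
  qed
qed simp

lemma offset_bound: "2 * offset w + 2 ^ downs w \<le> 2 ^ downs w * 3 ^ ups w"
proof (induction w rule: offset.induct)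
  case (2 w)
  have "3 ^ ups w \<le> (2::nat) ^ downs w * 3 ^ ups w" by simp
  moreover have "offset (True # w) = 3 ^ ups w + offset w" "(2::nat) ^ downs (True # w) = 2 ^ downs w"
    "(2::nat) ^ downs (True # w) * 3 ^ ups (True # w) = 3 * (2 ^ downs w * 3 ^ ups w)" by simp_all
  ultimately show ?case using 2 by linarith
qed simp_all

text \<open>
  Each pair of entries is ordered as the leading factor \<open>3 ^ a / 2 ^ b\<close> of the affine map between
  them predicts.
\<close>

definition asymptotic_order :: "nat \<Rightarrow> nat \<Rightarrow> bool" where
  "asymptotic_order n x \<longleftrightarrow>
     (\<forall>i j. i < j \<and> j < n \<longrightarrow>
       ((collatz ^^ i) x < (collatz ^^ j) x \<longleftrightarrow>
        2 ^ downs (parities (j - i) ((collatz ^^ i) x)) < (3::nat) ^ ups (parities (j - i) ((collatz ^^ i) x))))"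

lemma parities_segment:
  assumes "i \<le> j" "j \<le> n"
  shows "parities (j - i) ((collatz ^^ i) x) = take (j - i) (drop i (parities n x))"
proof -
  have "parities n x = parities i x @ parities (j - i) ((collatz ^^ i) x)
      @ parities (n - j) ((collatz ^^ j) x)"
    using parities_add[of i "n - i" x] parities_add[of "j - i" "n - j" "(collatz ^^ i) x"]
      funpow_collatz_add[of i "j - i" x] assms by simp
  then show ?thesis by simp
qed

text \<open>
  The leading factors depend only on the parity word.
\<close>

lemma collatz_perm_eq:
  assumes "has_trace n x" "has_trace n y" "parities n x = parities n y"
    and "asymptotic_order n x" "asymptotic_order n y"
  shows "collatz_perm x = collatz_perm y"
proof -
  note tx = has_trace_collatz_trace[OF assms(1)]
  note ty = has_trace_collatz_trace[OF assms(2)]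
  have up: "(collatz ^^ i) x < (collatz ^^ j) x \<longleftrightarrow> (collatz ^^ i) y < (collatz ^^ j) y"
    if "i < j" "j < n" for i j
    using assms(3-5) that unfolding asymptotic_order_def
    by (simp add: parities_segment[where n = n])
  have "(collatz ^^ i) x < (collatz ^^ j) x \<longleftrightarrow> (collatz ^^ i) y < (collatz ^^ j) y"
    if ij: "i < n" "j < n" for i j
  proof (cases i j rule: linorder_cases)
    case greater
    have "(collatz ^^ i) x \<noteq> (collatz ^^ j) x" "(collatz ^^ i) y \<noteq> (collatz ^^ j) y"
      using inj_onD[OF has_trace_inj[OF assms(1)], of i j]
        inj_onD[OF has_trace_inj[OF assms(2)], of i j] ij greater by auto
    then show ?thesis using up[OF greater ij(1)] by linarith
  qed (use up ij in auto)
  then show ?thesis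
    unfolding collatz_perm_def using tx ty by (intro standardize_eqI) auto
qed

lemma funpow_collatz_le:
  assumes "x > 0"
  shows "(collatz ^^ n) x \<le> 4 ^ ups (parities n x) * x"
  using assms
proof (induction n arbitrary: x)
  case (Suc n)
  have IH: "(collatz ^^ n) (collatz x) \<le> 4 ^ ups (parities n (collatz x)) * collatz x"
    using Suc.IH Suc.prems collatz_pos by blast
  have "collatz x \<le> (if odd x then 4 * x else x)"
    using Suc.prems by (auto simp: collatz_def)
  then have "4 ^ ups (parities n (collatz x)) * collatz x \<le>
      4 ^ ups (parities n (collatz x)) * (if odd x then 4 * x else x)"
    by (rule mult_left_mono) simp
  also have "\<dots> = 4 ^ ups (parities (Suc n) x) * x"
    by (simp add: parities_Suc)
  finally show ?case using IH by (simp add: funpow_swap1)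
qed simp

text \<open>
  With \<open>T = 3 ^ a\<close> and \<open>D = 2 ^ b\<close>, the hypotheses give \<open>(D - T) * x \<le> c\<close>, and \<open>2 * c < D * T\<close>
  by \<open>offset_bound\<close>.  If \<open>D \<ge> 2 * T\<close>, the factor \<open>D - T\<close> is at least \<open>D / 2\<close>, so \<open>x < T\<close>.
  Otherwise \<open>D - T \<ge> 1\<close> already gives \<open>x \<le> c < T * T\<close>.
\<close>

lemma exceptional_pair_small:
  assumes "x > 0" "x \<le> (collatz ^^ n) x" "3 ^ ups (parities n x) < (2::nat) ^ downs (parities n x)"
  shows "x < 9 ^ ups (parities n x)"
proof -
  define T :: nat where "T = 3 ^ ups (parities n x)"
  define D :: nat where "D = 2 ^ downs (parities n x)"
  define c where "c = offset (parities n x)"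
  have aff: "D * (collatz ^^ n) x = T * x + c"
    using funpow_collatz_affine[of n x] by (simp add: T_def D_def c_def)
  have bound: "2 * c + D \<le> D * T"
    using offset_bound[of "parities n x"] by (simp add: T_def D_def c_def)
  have T: "T \<ge> 1" and "T < D" using assms(3) by (simp_all add: T_def D_def)
  have le: "D * x \<le> T * x + c"
    using mult_le_mono2[OF assms(2), of D] aff by simp
  have "x < T * T"
  proof (cases "2 * T \<le> D")
    case True
    have "2 * T * x \<le> D * x" using True by (rule mult_le_mono1)
    with le have "D * x \<le> 2 * c" by linarith
    with bound \<open>T < D\<close> have "D * x < D * T" by linarith
    then have "x < T" by simp
    also have "T \<le> T * T" using T by simp
    finally show ?thesis .
  next
    case False
    have "(T + 1) * x \<le> D * x" using \<open>T < D\<close> by (intro mult_le_mono1) simp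
    with le have "x \<le> c" by simp
    moreover have "D * T \<le> 2 * (T * T)" using False mult_le_mono1[of D "2 * T" T] by simp
    ultimately show ?thesis using bound \<open>T < D\<close> by linarith
  qed
  also have "T * T = 9 ^ ups (parities n x)"
    by (simp add: T_def power_mult_distrib[symmetric])
  finally show ?thesis .
qed

text \<open>
  Only a leading factor below 1 can mispredict, since the offset is not negative.  The first entry of
  such a pair is less than \<open>9 ^ a\<close>, where \<open>a\<close> is smaller than the number \<open>A\<close> of up-steps in the
  trace, and afterwards every up-step gains at most a factor 4.  So the final power of two is less than
  \<open>4 ^ A * 9 ^ (A - 1) = 4 * 36 ^ (A - 1)\<close>; rounding 36 up to 64 gives the exponent.
\<close>

lemma exceptional_trace_end:
  assumes "has_trace n x" "\<not> asymptotic_order n x" "(collatz ^^ n) x = 2 ^ k"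
  shows "k + 4 < 6 * ups (parities n x)"
proof -
  let ?y = "\<lambda>i. (collatz ^^ i) x"
  have xpos: "x > 0" using has_traceD(1)[OF assms(1)] .
  obtain i j where ij: "i < j" "j < n"
    and bad: "(?y i < ?y j) \<noteq>
      (2 ^ downs (parities (j - i) (?y i)) < (3::nat) ^ ups (parities (j - i) (?y i)))"
    using assms(2) by (auto simp: asymptotic_order_def)
  define v where "v = parities (j - i) (?y i)"
  have yj: "(collatz ^^ (j - i)) (?y i) = ?y j"
    using funpow_collatz_add[of i "j - i" x] ij by simp
  have ypos: "?y l > 0" for l using xpos by (rule funpow_collatz_pos)
  have aff: "2 ^ downs v * ?y j = 3 ^ ups v * ?y i + offset v"
    using funpow_collatz_affine[of "j - i" "?y i"] yj by (simp add: v_def)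
  have "\<not> 2 ^ downs v < (3::nat) ^ ups v"
  proof
    assume less: "2 ^ downs v < (3::nat) ^ ups v"
    then have "\<not> ?y i < ?y j" using bad by (simp add: v_def)
    then have "2 ^ downs v * ?y j \<le> 2 ^ downs v * ?y i" by simp
    also have "\<dots> < 3 ^ ups v * ?y i" using less ypos by simp
    finally show False using aff by simp
  qed
  moreover have "2 ^ downs v \<noteq> (3::nat) ^ ups v"
  proof
    assume eq: "2 ^ downs v = (3::nat) ^ ups v"
    have "ups v + downs v = j - i"
      using ups_downs[of v] by (simp add: v_def)
    have "odd ((3::nat) ^ ups v)" by simp
    then have "downs v = 0" using eq by (metis even_power even_numeral neq0_conv)
    with eq have "(3::nat) ^ ups v = 1" by simp
    then have "ups v = 0" by (cases "ups v") simp_all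
    with \<open>downs v = 0\<close> \<open>ups v + downs v = j - i\<close> ij show False by simp
  qed
  ultimately have less: "3 ^ ups v < (2::nat) ^ downs v" by simp
  with bad have "?y i \<le> ?y j" by (auto simp: v_def)
  then have small: "?y i < 9 ^ ups v"
    using exceptional_pair_small[of "?y i" "j - i"] ypos yj less by (simp add: v_def)
  let ?u = "parities (n - i) (?y i)"
  have u: "?u = v @ parities (n - j) (?y j)"
    using parities_add[of "j - i" "n - j" "?y i"] yj ij by (simp add: v_def)
  have w: "parities n x = parities i x @ ?u"
    using parities_add[of i "n - i" x] ij by simp
  \<comment> \<open>The step from the last entry to the power of two is an up-step that lies after \<open>v\<close>.  Hence
    \<open>v\<close> has fewer up-steps than the trace.\<close>
  have ne: "parities (n - j) (?y j) \<noteq> []"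
    using ij by (simp add: parities_def)
  then have "last (parities (n - j) (?y j))"
    using last_parity_words[OF parities_in_parity_words[OF assms(1)]] by (simp add: w u)
  then have "True \<in> set (parities (n - j) (?y j))"
    using last_in_set[OF ne] by simp
  then have "ups (parities (n - j) (?y j)) \<ge> 1"
    by (metis count_notin count_list_0_iff less_one not_less)
  then have ups_u: "ups v + 1 \<le> ups ?u" unfolding u by simp
  have ups_w: "ups ?u \<le> ups (parities n x)" by (simp add: w)
  define A where "A = ups (parities n x) - 1"
  have A: "ups (parities n x) = Suc A" "ups v \<le> A" "ups ?u \<le> Suc A"
    using ups_u ups_w by (auto simp: A_def)
  have "2 ^ k = (collatz ^^ (n - i)) (?y i)"
    using funpow_collatz_add[of i "n - i" x] ij assms(3) by simp
  also have "\<dots> \<le> 4 ^ ups ?u * ?y i" using ypos by (rule funpow_collatz_le)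
  also have "\<dots> < 4 ^ ups ?u * 9 ^ ups v" using small by simp
  also have "\<dots> \<le> 4 ^ Suc A * 9 ^ A"
    using A by (intro mult_mono power_increasing) auto
  also have "\<dots> = 4 * 36 ^ A"
    by (simp add: power_mult_distrib[symmetric])
  also have "\<dots> \<le> 4 * 64 ^ A"
    by (intro mult_left_mono power_mono) auto
  also have "\<dots> = 2 ^ (2 + 6 * A)"
    by (simp add: power_add power_mult)
  finally have "k < 2 + 6 * A"
    by (rule power_less_imp_less_exp[rotated]) simp
  then show ?thesis using A by simp
qed

text \<open>
  Both starting points satisfy the same affine equation, so \<open>3 ^ A\<close> divides the difference of their
  final powers of two and the order of 2 modulo \<open>3 ^ A\<close> divides the difference of the exponents.
\<close>

lemma end_exponent_gap:
  assumes "has_trace n x" "has_trace n y" "parities n x = parities n y" "x < y"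
    and "(collatz ^^ n) x = 2 ^ k" "(collatz ^^ n) y = 2 ^ l"
  shows "k + 2 * 3 ^ (ups (parities n x) - 1) \<le> l"
proof -
  define w where "w = parities n x"
  have "w \<noteq> []" "last w"
    using last_parity_words[OF parities_in_parity_words[OF assms(1)]] by (simp_all add: w_def)
  then have "True \<in> set w" using last_in_set by fastforce
  then have a: "ups w > 0" by (metis count_list_0_iff gr0I)
  have ex: "2 ^ downs w * 2 ^ k = 3 ^ ups w * x + offset w"
    using funpow_collatz_affine[of n x] assms(5) by (simp add: w_def)
  have ey: "2 ^ downs w * 2 ^ l = 3 ^ ups w * y + offset w"
    using funpow_collatz_affine[of n y] assms(3,6) by (simp add: w_def)
  have "3 ^ ups w * x < 3 ^ ups w * y" using assms(4) by simp
  with ex ey have "(2::nat) ^ downs w * 2 ^ k < 2 ^ downs w * 2 ^ l" by linarith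
  then have "k < l" by simp
  have "[2 ^ downs w * 2 ^ l = (2 ^ downs w * 2 ^ k :: nat)] (mod 3 ^ ups w)"
    unfolding ex ey by (simp add: cong_def)
  then have "[(2 ^ downs w * 2 ^ k :: nat) * 2 ^ (l - k) = (2 ^ downs w * 2 ^ k) * 1] (mod 3 ^ ups w)"
    using \<open>k < l\<close> by (simp add: mult.assoc power_add[symmetric])
  moreover have pr: "residue_primroot (3 ^ ups w) 2" using a by (rule two_primroot_power_three)
  then have "coprime (2 ^ downs w * 2 ^ k) ((3::nat) ^ ups w)"
    by (simp add: residue_primroot_def coprime_commute)
  ultimately have "[2 ^ (l - k) = (1::nat)] (mod 3 ^ ups w)"
    using cong_mult_lcancel_nat by blast
  then have "totient (3 ^ ups w) dvd l - k"
    using pr unfolding ord_divides by (simp add: residue_primroot_def)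
  then have "totient (3 ^ ups w) \<le> l - k" using \<open>k < l\<close> by (intro dvd_imp_le) auto
  moreover have "totient (3 ^ ups w) = 2 * 3 ^ (ups w - 1)"
    using a by (simp add: totient_prime_power)
  ultimately show ?thesis using \<open>k < l\<close> by (simp add: w_def)
qed

text \<open>
  The exponent is at least \<open>3 + 2 * 3 ^ (A - 1)\<close> by \<open>trace_end\<close> and \<open>end_exponent_gap\<close>, which
  contradicts \<open>exceptional_trace_end\<close> because \<open>3 ^ m \<ge> 3 * m\<close>.
\<close>

lemma not_least_asymptotic_order:
  assumes "has_trace n x" "has_trace n y" "parities n x = parities n y" "x < y"
  shows "asymptotic_order n y"
proof (rule ccontr)
  assume bad: "\<not> asymptotic_order n y"
  obtain k l where kl: "(collatz ^^ n) x = 2 ^ k" "(collatz ^^ n) y = 2 ^ l"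
    using assms(1,2) by (auto simp: has_trace_def power_of_two_def)
  define A where "A = ups (parities n y) - 1"
  have l: "l + 4 < 6 * ups (parities n y)" using assms(2) bad kl(2) by (rule exceptional_trace_end)
  have "3 + 2 * 3 ^ A \<le> l"
    using end_exponent_gap[OF assms kl] trace_end[OF assms(1) kl(1)] assms(3) by (simp add: A_def)
  moreover have "3 * A \<le> 3 ^ A"
  proof (induction A)
    case (Suc A)
    then show ?case by (cases "A = 0") auto
  qed simp
  ultimately show False using l by (simp add: A_def)
qed

lemma card_collatz_perm_parities:
  fixes w :: "bool list" and n :: nat
  defines "S \<equiv> {x. has_trace n x \<and> parities n x = w}"
  shows "card (collatz_perm ` S) \<le> 2"
proof (cases "S = {}")
  case False
  define x0 where "x0 = (LEAST x. x \<in> S)"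
  have x0: "x0 \<in> S" using False LeastI_ex[of "\<lambda>x. x \<in> S"] by (auto simp: x0_def)
  have least: "x0 \<le> x" if "x \<in> S" for x using that Least_le by (metis x0_def)
  have asym: "asymptotic_order n x" if "x \<in> S" "x \<noteq> x0" for x
    using not_least_asymptotic_order[of n x0 x] x0 that least[of x] by (simp add: S_def)
  have "\<exists>q. collatz_perm ` S \<subseteq> {collatz_perm x0, q}"
  proof (cases "S = {x0}")
    case True
    then show ?thesis by auto
  next
    case False
    then obtain y where y: "y \<in> S" "y \<noteq> x0" using x0 by auto
    have "collatz_perm x = collatz_perm y" if "x \<in> S" "x \<noteq> x0" for x
      using that y asym by (intro collatz_perm_eq[of n]) (auto simp: S_def)
    then show ?thesis by blast
  qed
  then obtain q where q: "collatz_perm ` S \<subseteq> {collatz_perm x0, q}" ..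
  have "card (collatz_perm ` S) \<le> card {collatz_perm x0, q}"
    using q by (intro card_mono) auto
  also have "\<dots> \<le> 2" by (simp add: card_insert_if)
  finally show ?thesis .
qed simp

section \<open>Counting Collatz permutations\<close>

theorem mainTheorem3:
  fixes n :: nat
  assumes "collatz_conjecture"
    and "n \<ge> 1"
  shows "fib n \<le> card (collatz_permutations n) \<and> card (collatz_permutations n) \<le> 2 * fib n"
proof
  let ?F = "\<lambda>w. collatz_perm ` {x. has_trace n x \<and> parities n x = w}"
  have eq: "collatz_permutations n = collatz_perm ` {x. has_trace n x}"
    using assms(1) by (rule collatz_permutations_eq)
  have fin: "finite (collatz_permutations n)"
    unfolding collatz_permutations_def by simp
  have "parity_words n \<subseteq> perm_word ` collatz_permutations n"
  proof
    fix w assume "w \<in> parity_words n"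
    then obtain x where "has_trace n x" "parities n x = w" using parity_word_has_trace by blast
    then show "w \<in> perm_word ` collatz_permutations n"
      unfolding eq using perm_word_collatz_perm[of n x] by (auto simp: image_iff)
  qed
  then show "fib n \<le> card (collatz_permutations n)"
    using surj_card_le[OF fin, of "parity_words n" perm_word] by (simp add: card_parity_words)
  have "collatz_permutations n = (\<Union>w\<in>parity_words n. ?F w)"
    unfolding eq using parities_in_parity_words by auto
  also have "card \<dots> \<le> (\<Sum>w\<in>parity_words n. card (?F w))"
    by (intro card_UN_le) simp
  also have "\<dots> \<le> (\<Sum>w\<in>parity_words n. 2)"
    using card_collatz_perm_parities by (intro sum_mono) blast
  finally show "card (collatz_permutations n) \<le> 2 * fib n"
    by (simp add: card_parity_words mult.commute)
qed

end
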